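(* Let $f:\mathbb{N}_0\to\mathbb{N}_0$ be a function, and let $\{a_n\}$ be defined by $a_n=1$ for all integers $n<1$ and $a_n=a_{n-1}+a_{n-1-f(n-1)}$ for $n\ge 1$. Then $\{a_n\}_{n=0}^\infty$ is the only increasing sequence of natural numbers, indexed by $n\ge 0$, with the property that every positive integer has a unique $f$-decomposition using the sequence.
   Context: $\mathbb{N}_0=\{0,1,2,\dots\}$, and natural numbers are positive integers. Given $f:\mathbb{N}_0\to\mathbb{N}_0$ and a sequence $\{a_n\}_{n=0}^\infty$, an $f$-decomposition of $x$ using $\{a_n\}$ is a finite sum $x=\sum_{i} a_{n_i}$ of terms of the sequence with pairwise distinct indices $n_i\ge 0$, such that for every $a_{n_i}$ in the sum, the previous $f(n_i)$ terms $a_{n_i-f(n_i)},a_{n_i-f(n_i)+1},\dots,a_{n_i-1}$ (those among them with index $\ge 0$) are not in the sum. Two $f$-decompositions are the same if they use the same set of indices. The values $a_n$ with $n<0$ serve only to define the recursion; they are not available as summands. *)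

theory Defs
  imports Main
begin

text \<open>The recursion is indexed by the integers. For \<open>n \<ge> 1\<close> the argument \<open>n - 1\<close> of \<open>f\<close> is
  nonnegative, so the conversion \<open>nat (n - 1)\<close> loses nothing.\<close>

function f_sequence :: "(nat \<Rightarrow> nat) \<Rightarrow> int \<Rightarrow> nat" where
  "f_sequence f n =
    (if n < 1 then 1
     else f_sequence f (n - 1) + f_sequence f (n - 1 - int (f (nat (n - 1)))))"
  by pat_completeness auto
termination
  by (relation "measure (\<lambda>(f, n). nat n)") auto

declare f_sequence.simps [simp del]

text \<open>A decomposition is identified with its set \<open>I\<close> of indices. Subtraction on \<^typ>\<open>nat\<close> truncates
  at 0, so \<open>{n - f n..<n}\<close> consists of those of the \<open>f n\<close> indices preceding \<open>n\<close> that are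
  nonnegative.\<close>

definition f_decomposition ::
    "(nat \<Rightarrow> nat) \<Rightarrow> (nat \<Rightarrow> nat) \<Rightarrow> nat \<Rightarrow> nat set \<Rightarrow> bool" where
  "f_decomposition f a x I \<longleftrightarrow>
     finite I \<and> x = (\<Sum>n\<in>I. a n) \<and> (\<forall>n\<in>I. {n - f n..<n} \<inter> I = {})"

definition unique_f_decompositions :: "(nat \<Rightarrow> nat) \<Rightarrow> (nat \<Rightarrow> nat) \<Rightarrow> bool" where
  "unique_f_decompositions f a \<longleftrightarrow> (\<forall>x>0. \<exists>!I. f_decomposition f a x I)"

end

theory Submission
  imports Defs
begin

text \<open>Let \<open>a\<close> be the recursively defined sequence. The idea is to count by the largest index: the
  admissible index sets below \<open>n\<close> represent each of \<open>0, \<dots>, a n - 1\<close> exactly once. Indeed, an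
  admissible set below \<open>n + 1\<close> either avoids \<open>n\<close>, and then its sum ranges over \<open>[0, a n)\<close>, or it
  contains \<open>n\<close>, and then the remaining indices form an arbitrary admissible set below \<open>n - f n\<close>, so
  that its sum ranges over \<open>[a n, a n + a (n - f n))\<close>. By the recursion these two intervals tile
  \<open>[0, a (n + 1))\<close> (\<open>bij_betw_sum_admissible\<close>). As \<open>a\<close> is unbounded, existence and uniqueness of
  decompositions follow.

  Conversely, let \<open>b\<close> be an increasing positive sequence with unique decompositions that agrees with
  \<open>a\<close> below \<open>n\<close>. The indices below \<open>n\<close> represent exactly the numbers less than \<open>a n\<close>. Hence the
  decomposition of \<open>a n\<close> needs an index at least \<open>n\<close>, which gives \<open>b n \<le> a n\<close>; and \<open>b n < a n\<close> would
  give \<open>b n\<close> two decompositions, one below \<open>n\<close> and the singleton \<open>{n}\<close>.\<close>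

definition admissible_below :: "(nat \<Rightarrow> nat) \<Rightarrow> nat \<Rightarrow> nat set set" where
  "admissible_below f n = {I. I \<subseteq> {..<n} \<and> (\<forall>k\<in>I. {k - f k..<k} \<inter> I = {})}"

lemma f_sequence_0: "f_sequence f 0 = 1"
  by (simp add: f_sequence.simps)

text \<open>Truncated subtraction is harmless here: when \<open>n - f n\<close> is negative as an integer, the sequence
  has the value 1 there, which is also its value at 0.\<close>

lemma f_sequence_Suc:
  "f_sequence f (int (Suc n)) = f_sequence f (int n) + f_sequence f (int (n - f n))"
proof -
  have "f_sequence f (int n - int (f n)) = f_sequence f (int (n - f n))"
  proof (cases "f n \<le> n")
    case False
    then show ?thesis by (simp add: f_sequence.simps)
  qed (simp add: of_nat_diff)
  then show ?thesis by (subst f_sequence.simps) simp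
qed

lemma f_sequence_pos: "f_sequence f n > 0"
  by (induction f n rule: f_sequence.induct) (subst f_sequence.simps, simp)

lemma strict_mono_f_sequence: "strict_mono (\<lambda>n. f_sequence f (int n))"
  unfolding strict_mono_Suc_iff f_sequence_Suc using f_sequence_pos by simp

lemma admissible_below_0: "admissible_below f 0 = {{}}"
  by (auto simp: admissible_below_def)

text \<open>Only the gap condition at the maximal index \<open>n\<close> links \<open>n\<close> to the smaller indices, and it says
  precisely that these lie below \<open>n - f n\<close>.\<close>

lemma admissible_below_Suc:
  "admissible_below f (Suc n)
     = admissible_below f n \<union> insert n ` admissible_below f (n - f n)"
proof (intro set_eqI iffI)
  fix I
  assume I: "I \<in> admissible_below f (Suc n)"
  show "I \<in> admissible_below f n \<union> insert n ` admissible_below f (n - f n)"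
  proof (cases "n \<in> I")
    case True
    have "k < n - f n" if "k \<in> I - {n}" for k
    proof (rule ccontr)
      assume "\<not> k < n - f n"
      moreover have "k < n"
        using I that by (auto simp: admissible_below_def less_Suc_eq)
      ultimately have "k \<in> {n - f n..<n} \<inter> I" using that by auto
      then show False using I True unfolding admissible_below_def by blast
    qed
    then have "I - {n} \<in> admissible_below f (n - f n)"
      using I unfolding admissible_below_def by blast
    moreover have "I = insert n (I - {n})" using True by auto
    ultimately show ?thesis by blast
  next
    case False
    then have "I \<in> admissible_below f n"
      using I by (auto simp: admissible_below_def less_Suc_eq)
    then show ?thesis by blast
  qed
next
  fix I
  assume "I \<in> admissible_below f n \<union> insert n ` admissible_below f (n - f n)"
  then show "I \<in> admissible_below f (Suc n)"
    by (force simp: admissible_below_def)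
qed

lemma bij_betw_sum_admissible:
  "bij_betw (\<lambda>I. \<Sum>k\<in>I. f_sequence f (int k)) (admissible_below f n) {..<f_sequence f (int n)}"
proof (induction n rule: less_induct)
  case (less n)
  define a where "a = (\<lambda>n. f_sequence f (int n))"
  have IH: "bij_betw (sum a) (admissible_below f m) {..<a m}" if "m < n" for m
    using less.IH[OF that] by (simp add: a_def)
  have "bij_betw (sum a) (admissible_below f n) {..<a n}"
  proof (cases n)
    case 0
    then show ?thesis
      by (auto simp: bij_betw_def admissible_below_0 a_def f_sequence_0)
  next
    case (Suc m)
    define d where "d = m - f m"
    have sum_insert: "sum a (insert m I) = a m + sum a I" if "I \<in> admissible_below f d" for I
    proof (rule sum.insert)
      show "finite I"
        using that finite_subset[of I "{..<d}"] by (auto simp: admissible_below_def)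
      show "m \<notin> I" using that by (auto simp: admissible_below_def d_def)
    qed
    have d_bij: "bij_betw (sum a) (admissible_below f d) {..<a d}"
      by (rule IH) (simp add: d_def Suc)
    have "sum a ` insert m ` admissible_below f d = (+) (a m) ` sum a ` admissible_below f d"
      unfolding image_image using sum_insert by (rule image_cong[OF refl])
    also have "\<dots> = {a m..<a m + a d}"
      using d_bij by (simp add: bij_betw_def lessThan_atLeast0 add.commute)
    finally have image: "sum a ` insert m ` admissible_below f d = {a m..<a m + a d}" .
    have "inj_on (sum a) (insert m ` admissible_below f d)"
    proof (rule inj_onI, elim imageE)
      fix I J x y
      assume eq: "sum a x = sum a y"
        and x: "x = insert m I" "I \<in> admissible_below f d"
        and y: "y = insert m J" "J \<in> admissible_below f d"
      then have "sum a I = sum a J" by (simp add: sum_insert)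
      then have "I = J" using d_bij x y by (auto simp: bij_betw_def inj_on_def)
      then show "x = y" using x y by simp
    qed
    then have "bij_betw (sum a) (insert m ` admissible_below f d) {a m..<a m + a d}"
      using image by (simp add: bij_betw_def)
    then have "bij_betw (sum a) (admissible_below f m \<union> insert m ` admissible_below f d)
        ({..<a m} \<union> {a m..<a m + a d})"
      by (intro bij_betw_combine IH) (auto simp: Suc)
    moreover have "{..<a m} \<union> {a m..<a m + a d} = {..<a n}"
      using f_sequence_Suc[of f m] by (auto simp: a_def d_def Suc)
    ultimately show ?thesis by (simp add: Suc admissible_below_Suc d_def)
  qed
  then show ?case by (simp add: a_def)
qed

lemma f_decomposition_iff_admissible:
  assumes "I \<subseteq> {..<n}"
  shows "f_decomposition f a x I \<longleftrightarrow> I \<in> admissible_below f n \<and> x = sum a I"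
  using assms finite_subset[OF assms] by (auto simp: f_decomposition_def admissible_below_def)

lemma f_decomposition_singleton: "f_decomposition f a (a n) {n}"
  by (simp add: f_decomposition_def)

text \<open>The next two lemmas speak of an arbitrary sequence that agrees with the recursive one below
  \<open>n\<close>: this is the situation in the inductive proof that the sequence is determined by its
  decompositions.\<close>

lemma exists_f_decomposition_below:
  assumes "\<And>k. k < n \<Longrightarrow> b k = f_sequence f (int k)" and "x < f_sequence f (int n)"
  obtains I where "I \<subseteq> {..<n}" "f_decomposition f b x I"
proof -
  obtain I where I: "I \<in> admissible_below f n" "x = (\<Sum>k\<in>I. f_sequence f (int k))"
    using bij_betw_sum_admissible[of f n] assms(2) by (auto simp: bij_betw_def)
  then have sub: "I \<subseteq> {..<n}" by (simp add: admissible_below_def)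
  then have "x = sum b I" using I assms(1) by (auto intro!: sum.cong)
  with I sub show thesis by (intro that) (auto simp: f_decomposition_iff_admissible)
qed

lemma f_decomposition_below_less:
  assumes "\<And>k. k < n \<Longrightarrow> b k = f_sequence f (int k)"
    and "I \<subseteq> {..<n}" "f_decomposition f b x I"
  shows "x < f_sequence f (int n)"
proof -
  have I: "I \<in> admissible_below f n" "x = sum b I"
    using assms by (auto simp: f_decomposition_iff_admissible)
  then have "x = (\<Sum>k\<in>I. f_sequence f (int k))" using assms by (auto intro!: sum.cong)
  then show ?thesis
    using I bij_betw_sum_admissible[of f n] by (auto simp: bij_betw_def)
qed

lemma unique_f_decompositions_f_sequence:
  "unique_f_decompositions f (\<lambda>n. f_sequence f (int n))"
  unfolding unique_f_decompositions_def
proof (intro allI impI ex_ex1I)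
  fix x :: nat
  have "x \<le> f_sequence f (int x)"
    by (rule strict_mono_imp_increasing[OF strict_mono_f_sequence])
  also have "\<dots> < f_sequence f (int (Suc x))"
    using strict_mono_f_sequence by (rule strict_monoD) simp
  finally obtain I where "f_decomposition f (\<lambda>n. f_sequence f (int n)) x I"
    using exists_f_decomposition_below[of "Suc x" "\<lambda>n. f_sequence f (int n)" f x] by blast
  then show "\<exists>I. f_decomposition f (\<lambda>n. f_sequence f (int n)) x I" ..
next
  fix x I J
  assume dec: "f_decomposition f (\<lambda>n. f_sequence f (int n)) x I"
    "f_decomposition f (\<lambda>n. f_sequence f (int n)) x J"
  then have "finite (I \<union> J)" by (simp add: f_decomposition_def)
  then obtain n where n: "I \<union> J \<subseteq> {..<n}" by (auto simp: finite_nat_set_iff_bounded)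
  then have "I \<in> admissible_below f n" "J \<in> admissible_below f n"
    "(\<Sum>k\<in>I. f_sequence f (int k)) = (\<Sum>k\<in>J. f_sequence f (int k))"
    using dec by (auto simp: f_decomposition_iff_admissible)
  then show "I = J"
    using bij_betw_sum_admissible[of f n] by (auto simp: bij_betw_def inj_on_def)
qed

lemma eq_f_sequence_if_unique_f_decompositions:
  assumes mono: "strict_mono b" and pos: "\<And>n. b n > 0" and uniq: "unique_f_decompositions f b"
  shows "b n = f_sequence f (int n)"
proof (induction n rule: less_induct)
  case (less n)
  show ?case
  proof (rule antisym)
    obtain I where I: "f_decomposition f b (f_sequence f (int n)) I"
      using uniq f_sequence_pos unfolding unique_f_decompositions_def by blast
    have "\<not> I \<subseteq> {..<n}"
      using f_decomposition_below_less[OF less.IH _ I] by blast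
    then obtain m where m: "m \<in> I" "n \<le> m" by (auto simp: subset_iff not_less)
    have "b n \<le> b m" using m mono by (simp add: strict_mono_less_eq)
    also have "b m \<le> sum b I"
      using I m by (intro member_le_sum) (auto simp: f_decomposition_def)
    finally show "b n \<le> f_sequence f (int n)" using I by (simp add: f_decomposition_def)
  next
    show "f_sequence f (int n) \<le> b n"
    proof (rule ccontr)
      assume "\<not> f_sequence f (int n) \<le> b n"
      then obtain I where I: "I \<subseteq> {..<n}" "f_decomposition f b (b n) I"
        using exists_f_decomposition_below[OF less.IH, of n "b n"] by auto
      then have "I = {n}"
        using uniq pos[of n] f_decomposition_singleton
        unfolding unique_f_decompositions_def by blast
      then show False using I by simp
    qed
  qed
qed

theorem theorem1p3:
  fixes f :: "nat \<Rightarrow> nat" and b :: "nat \<Rightarrow> nat"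
  shows "strict_mono b \<and> (\<forall>n. b n > 0) \<and> unique_f_decompositions f b
     \<longleftrightarrow> b = (\<lambda>n. f_sequence f (int n))"
  using eq_f_sequence_if_unique_f_decompositions strict_mono_f_sequence f_sequence_pos
    unique_f_decompositions_f_sequence
  by blast

end
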